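(* Let $r$ be an odd positive integer, $n=4r$, $BL_r=2^{2r}+2^r+1$, and $a\in\{1,\dots,2^n-2\}$ with binary expansion $a=\sum_{i=0}^{n-1}a_i2^i$. The following are equivalent: (a) $a$ is the inverse of $BL_r$ modulo $2^n-1$; (b) there exists a sequence $(c_{n-1},\dots,c_0)$ with $c_i\in\{0,1,2\}$ such that $$2c_0-c_{-1}+1=a_{-2r}+a_{-r}+a_0,\qquad 2c_i-c_{i-1}=a_{i-2r}+a_{i-r}+a_i\ \text{ for all } i\in\{1,\dots,n-1\},$$ where indices are taken modulo $n$. Moreover, the sequence $c$ in (b) is unique. *)

theory Defs
  imports "HOL-Number_Theory.Cong" "HOL-Library.FuncSet"
begin

definition BL :: "nat \<Rightarrow> int" where
  "BL r = 2 ^ (2 * r) + 2 ^ r + 1"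

text \<open>The entry \<open>s\<^sub>k\<close> of a finite sequence \<open>s\<^sub>0, \<dots>, s\<^sub>n\<^sub>-\<^sub>1\<close>, with the index \<open>k\<close> read modulo \<open>n\<close>.\<close>
definition cyc :: "nat \<Rightarrow> (nat \<Rightarrow> 'a) \<Rightarrow> int \<Rightarrow> 'a" where
  "cyc n s k = s (nat (k mod int n))"

definition binary_expansion :: "nat \<Rightarrow> int \<Rightarrow> (nat \<Rightarrow> int) \<Rightarrow> bool" where
  "binary_expansion n a d \<longleftrightarrow> (\<forall>i<n. d i \<in> {0, 1}) \<and> a = (\<Sum>i<n. d i * 2 ^ i)"

text \<open>Here \<open>d\<close> holds the binary digits of \<open>a\<close>. A sequence \<open>c\<close> of length \<open>4 * r\<close> is an extensional
  function on \<open>{..<4 * r}\<close>, so that equality of sequences is equality of functions.\<close>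
definition carry_sequence :: "nat \<Rightarrow> (nat \<Rightarrow> int) \<Rightarrow> (nat \<Rightarrow> int) \<Rightarrow> bool" where
  "carry_sequence r d c \<longleftrightarrow>
    c \<in> {..<4 * r} \<rightarrow>\<^sub>E {0, 1, 2} \<and>
    2 * cyc (4 * r) c 0 - cyc (4 * r) c (- 1) + 1 =
      cyc (4 * r) d (- 2 * int r) + cyc (4 * r) d (- int r) + cyc (4 * r) d 0 \<and>
    (\<forall>i \<in> {1..int (4 * r) - 1}.
      2 * cyc (4 * r) c i - cyc (4 * r) c (i - 1) =
        cyc (4 * r) d (i - 2 * int r) + cyc (4 * r) d (i - int r) + cyc (4 * r) d i)"

end

theory Submission
  imports Defs
begin

text \<open>Write \<open>s\<^sub>i\<close> for the right-hand sides of the carry equations and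
  \<open>S = \<Sum>\<^sub>i s\<^sub>i 2\<^sup>i\<close>. Rotating the digits of \<open>a\<close> by \<open>k\<close> places multiplies \<open>a\<close> by \<open>2\<^sup>k\<close> modulo
  \<open>2\<^sup>n - 1\<close>, so \<open>S\<close> is congruent to \<open>a BL\<^sub>r\<close>. Weighting the carry equations with \<open>2\<^sup>i\<close> makes them
  telescope to \<open>c\<^sub>i 2\<^sup>i\<^sup>+\<^sup>1 = \<Sum>\<^sub>j\<^sub>\<le>\<^sub>i s\<^sub>j 2\<^sup>j - 1 + c\<^sub>n\<^sub>-\<^sub>1\<close>. The case \<open>i = n - 1\<close> reads
  \<open>c\<^sub>n\<^sub>-\<^sub>1 (2\<^sup>n - 1) = S - 1\<close>: it gives the congruence \<open>S \<equiv> 1\<close>, and it determines \<open>c\<^sub>n\<^sub>-\<^sub>1\<close>, hence all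
  of \<open>c\<close>. Conversely, if \<open>S \<equiv> 1\<close>, this formula with \<open>c\<^sub>n\<^sub>-\<^sub>1 = (S - 1) / (2\<^sup>n - 1)\<close> defines integers,
  and \<open>0 \<le> s\<^sub>i \<le> 3\<close> confines them to \<open>{0, 1, 2}\<close>.\<close>

text \<open>One more rotation doubles the sum, except that the top digit gets weight 1 instead of
  \<open>2 ^ n\<close>. This changes the value by a multiple of \<open>2 ^ n - 1\<close>.\<close>

lemma sum_rotate_cong:
  fixes f :: "int \<Rightarrow> int"
  assumes "n > 0" and periodic: "\<And>i. f (i + int n) = f i"
  shows "[(\<Sum>i<n. f (int i - int k) * 2 ^ i) = (\<Sum>i<n. f (int i) * 2 ^ i) * 2 ^ k] (mod (2 ^ n - 1))"
proof (induction k)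
  case 0
  show ?case by simp
next
  case (Suc k)
  let ?T = "\<lambda>k. \<Sum>i<n. f (int i - int k) * 2 ^ i"
  obtain m where m: "n = Suc m" using \<open>n > 0\<close> gr0_implies_Suc by blast
  let ?x = "f (int m - int k)"
  have "f (- 1 - int k) = ?x"
    using periodic[of "- 1 - int k"] by (simp add: m algebra_simps)
  then have "?T (Suc k) = ?x + 2 * (\<Sum>i<m. f (int i - int k) * 2 ^ i)"
    unfolding m sum.lessThan_Suc_shift
    by (simp add: sum_distrib_left algebra_simps)
  also have "\<dots> = 2 * ?T k - (2 ^ n - 1) * ?x"
    by (simp add: m algebra_simps)
  finally have "?T (Suc k) = 2 * ?T k - (2 ^ n - 1) * ?x" .
  then have "[?T (Suc k) = 2 * ?T k] (mod (2 ^ n - 1))"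
    by (simp add: cong_iff_dvd_diff)
  moreover have "[2 * ?T k = 2 * ((\<Sum>i<n. f (int i) * 2 ^ i) * 2 ^ k)] (mod (2 ^ n - 1))"
    by (rule cong_scalar_left[OF Suc.IH])
  ultimately have "[?T (Suc k) = 2 * ((\<Sum>i<n. f (int i) * 2 ^ i) * 2 ^ k)] (mod (2 ^ n - 1))"
    by (rule cong_trans)
  then show ?case
    by (simp only: power_Suc mult.left_commute)
qed

text \<open>The wrap-around carry is a free parameter \<open>q\<close>, which breaks the cycle: the
  equations become an ordinary recursion, and induction on \<open>i\<close> applies.\<close>

lemma carry_partial_sum:
  fixes s c :: "nat \<Rightarrow> int"
  assumes "2 * c 0 - q + 1 = s 0"
    and "\<And>i. Suc i < n \<Longrightarrow> 2 * c (Suc i) - c i = s (Suc i)"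
    and "i < n"
  shows "2 ^ Suc i * c i = (\<Sum>j<Suc i. s j * 2 ^ j) - 1 + q"
  using assms(3)
proof (induction i)
  case 0
  then show ?case using assms(1) by simp
next
  case (Suc i)
  have "2 ^ Suc (Suc i) * c (Suc i) = 2 ^ Suc i * (c i + s (Suc i))"
    using assms(2)[OF Suc.prems] by simp
  also have "\<dots> = 2 ^ Suc i * c i + s (Suc i) * 2 ^ Suc i"
    by (simp add: algebra_simps)
  finally show ?case using Suc by simp
qed

lemma carry_exists:
  fixes s :: "nat \<Rightarrow> int"
  assumes "n > 1"
    and s: "\<And>i. i < n \<Longrightarrow> s i \<in> {0..3}"
    and S: "[(\<Sum>i<n. s i * 2 ^ i) = 1] (mod (2 ^ n - 1))"
  obtains c :: "nat \<Rightarrow> int" where "\<And>i. i < n \<Longrightarrow> c i \<in> {0, 1, 2}"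
    and "2 * c 0 - c (n - 1) + 1 = s 0"
    and "\<And>i. Suc i < n \<Longrightarrow> 2 * c (Suc i) - c i = s (Suc i)"
proof -
  define P where "P i = (\<Sum>j<i. s j * 2 ^ j)" for i
  have "(2::int) ^ 2 \<le> 2 ^ n"
    using \<open>n > 1\<close> by (intro power_increasing) auto
  then have M: "(2 :: int) ^ n - 1 > 2" by simp
  obtain q where q: "P n - 1 = (2 ^ n - 1) * q"
    using S unfolding P_def cong_iff_dvd_diff by (auto elim: dvdE)
  have "0 \<le> P n"
    unfolding P_def using s by (intro sum_nonneg) auto
  \<comment> \<open>\<open>P n - 1\<close> is at least -1, and the modulus exceeds 1, so
    \<open>q\<close> lies strictly above -1.\<close>
  then have "(2 ^ n - 1) * (- 1) < (2 ^ n - 1) * q"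
    unfolding q[symmetric] using M \<open>0 \<le> P n\<close> by simp
  then have "q \<ge> 0" using M by (simp only: mult_less_cancel_left_pos)
  have "P n \<le> (\<Sum>i<n. 3 * 2 ^ i)"
    unfolding P_def using s by (intro sum_mono mult_right_mono) auto
  also have "\<dots> = 3 * (2 ^ n - 1)"
    by (simp add: sum_distrib_left[symmetric] mask_eq_sum_exp[symmetric] lessThan_def)
  \<comment> \<open>Subtracting 1 from \<open>P n\<close> makes the bound strict, which excludes
    \<open>q = 3\<close>.\<close>
  finally have "(2 ^ n - 1) * q < (2 ^ n - 1) * 3"
    unfolding q[symmetric] by simp
  then have "q < 3" using M by (simp only: mult_less_cancel_left_pos)

  define c where "c i = (P (Suc i) - 1 + q) div 2 ^ Suc i" for i
  \<comment> \<open>The division in \<open>c\<close> is exact, by downward induction: at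
    \<open>n\<close> the value is \<open>2 ^ n * q\<close>, and passing from \<open>Suc k\<close> to
    \<open>k\<close> removes a multiple of \<open>2 ^ k\<close>.\<close>
  have dvd: "2 ^ k dvd P k - 1 + q" if "k \<le> n" for k
    using that
  proof (induction k rule: inc_induct)
    case base
    have "P n - 1 + q = 2 ^ n * q" using q by (simp add: algebra_simps)
    then show ?case by simp
  next
    case (step k)
    have "2 ^ k dvd P (Suc k) - 1 + q"
      using step.IH by (rule power_le_dvd) simp
    moreover have "P k - 1 + q = (P (Suc k) - 1 + q) - s k * 2 ^ k"
      by (simp add: P_def)
    ultimately show ?case by (metis dvd_diff dvd_triv_right)
  qed
  have c: "2 ^ Suc i * c i = P (Suc i) - 1 + q" if "i < n" for i
    using dvd[of "Suc i"] that unfolding c_def by (intro dvd_mult_div_cancel) simp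
  have c0: "2 * c 0 - q + 1 = s 0"
    using c[of 0] \<open>n > 1\<close> by (simp add: P_def)
  have step: "2 * c (Suc i) - c i = s (Suc i)" if "Suc i < n" for i
  proof -
    have "2 ^ Suc i * (2 * c (Suc i)) = 2 ^ Suc i * (c i + s (Suc i))"
      using c[of i] c[OF that] that by (simp add: P_def algebra_simps)
    then show ?thesis by simp
  qed
  have "2 ^ n * c (n - 1) = 2 ^ n * q"
    using c[of "n - 1"] q \<open>n > 1\<close> by (simp add: algebra_simps)
  then have last: "c (n - 1) = q" by simp
  \<comment> \<open>Integrality closes the gaps: \<open>2 * c i\<close> lies between -1 and 5, where
    -1 can arise only at \<open>i = 0\<close> and 5 only later.\<close>
  have "0 \<le> c i \<and> c i \<le> 2" if "i < n" for i
    using that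
  proof (induction i)
    case 0
    then show ?case using c0 s[of 0] \<open>q \<ge> 0\<close> \<open>q < 3\<close> by auto
  next
    case (Suc i)
    then show ?case using step[of i] s[of "Suc i"] by auto
  qed
  then have "c i \<in> {0, 1, 2}" if "i < n" for i
    using that by force
  moreover have "2 * c 0 - c (n - 1) + 1 = s 0"
    using c0 last by simp
  ultimately show ?thesis
    using that step by blast
qed

text \<open>These are the \<open>s\<^sub>i\<close> above; the natural index gives the equation at 0
  and the others one common form.\<close>

definition digit_sum :: "nat \<Rightarrow> (nat \<Rightarrow> int) \<Rightarrow> nat \<Rightarrow> int" where
  "digit_sum r d i =
    cyc (4 * r) d (int i - 2 * int r) + cyc (4 * r) d (int i - int r) + cyc (4 * r) d (int i)"

text \<open>The shifts by \<open>2 * r\<close>, \<open>r\<close> and 0 contribute the three powers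
  of two that make up \<open>BL r\<close>.\<close>

lemma digit_sum_cong:
  assumes "r > 0" and "a = (\<Sum>i<4 * r. d i * 2 ^ i)"
  shows "[(\<Sum>i<4 * r. digit_sum r d i * 2 ^ i) = a * BL r] (mod (2 ^ (4 * r) - 1))"
proof -
  let ?f = "cyc (4 * r) d"
  have rot: "[(\<Sum>i<4 * r. ?f (int i - int k) * 2 ^ i) = a * 2 ^ k] (mod (2 ^ (4 * r) - 1))" for k
  proof -
    have "a = (\<Sum>i<4 * r. ?f (int i) * 2 ^ i)"
      using assms(2) by (simp add: cyc_def zmod_int[symmetric] del: of_nat_mult)
    then show ?thesis
      using sum_rotate_cong[of "4 * r" ?f k] \<open>r > 0\<close> by (simp add: cyc_def)
  qed
  have "(\<Sum>i<4 * r. digit_sum r d i * 2 ^ i) =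
      (\<Sum>i<4 * r. ?f (int i - int (2 * r)) * 2 ^ i) + (\<Sum>i<4 * r. ?f (int i - int r) * 2 ^ i)
      + (\<Sum>i<4 * r. ?f (int i - int 0) * 2 ^ i)"
    by (simp add: digit_sum_def algebra_simps sum.distrib)
  moreover have "a * BL r = a * 2 ^ (2 * r) + a * 2 ^ r + a * 2 ^ 0"
    by (simp add: BL_def algebra_simps)
  ultimately show ?thesis
    by (simp only: cong_add rot)
qed

lemma digit_sum_range:
  assumes "r > 0" and "\<And>i. i < 4 * r \<Longrightarrow> d i \<in> {0, 1}"
  shows "digit_sum r d i \<in> {0..3}"
proof -
  have "cyc (4 * r) d k \<in> {0, 1}" for k
    unfolding cyc_def using \<open>r > 0\<close> by (intro assms(2)) (simp add: nat_less_iff)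
  then have "0 \<le> cyc (4 * r) d k \<and> cyc (4 * r) d k \<le> 1" for k
    by (metis insert_iff singletonD order_refl zero_le_one)
  then show ?thesis
    unfolding digit_sum_def atLeastAtMost_iff by (smt (verit))
qed

text \<open>Moves the carries from cyclic integer indices to natural ones; the only carry index that
  wraps is -1, which becomes \<open>4 * r - 1\<close>.\<close>

lemma carry_sequence_iff:
  assumes "r > 0"
  shows "carry_sequence r d c \<longleftrightarrow>
    c \<in> {..<4 * r} \<rightarrow>\<^sub>E {0, 1, 2} \<and>
    2 * c 0 - c (4 * r - 1) + 1 = digit_sum r d 0 \<and>
    (\<forall>i. Suc i < 4 * r \<longrightarrow> 2 * c (Suc i) - c i = digit_sum r d (Suc i))"
proof -
  have cyc_int: "cyc (4 * r) c (int i) = c i" if "i < 4 * r" for i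
    using that by (simp add: cyc_def)
  have "(- 1) mod int (4 * r) = int (4 * r - 1)"
    using \<open>r > 0\<close> by (simp add: zmod_minus1)
  then have cyc_last: "cyc (4 * r) c (- 1) = c (4 * r - 1)"
    by (simp only: cyc_def nat_int)
  have cyc_first: "cyc (4 * r) c 0 = c 0"
    by (simp add: cyc_def)
  have digit_sum_0: "cyc (4 * r) d (- 2 * int r) + cyc (4 * r) d (- int r) + cyc (4 * r) d 0 =
      digit_sum r d 0"
    by (simp add: digit_sum_def)
  have range: "(\<forall>i \<in> {1..int (4 * r) - 1}. Q i) \<longleftrightarrow> (\<forall>i. Suc i < 4 * r \<longrightarrow> Q (int (Suc i)))" for Q
  proof
    assume R: "\<forall>i. Suc i < 4 * r \<longrightarrow> Q (int (Suc i))"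
    show "\<forall>i \<in> {1..int (4 * r) - 1}. Q i"
    proof
      fix i assume "i \<in> {1..int (4 * r) - 1}"
      then have "Suc (nat (i - 1)) < 4 * r" "int (Suc (nat (i - 1))) = i" by auto
      then show "Q i" using R by metis
    qed
  qed auto
  have "2 * cyc (4 * r) c (int (Suc i)) - cyc (4 * r) c (int (Suc i) - 1) = 2 * c (Suc i) - c i"
    if "Suc i < 4 * r" for i
    using cyc_int[of "Suc i"] cyc_int[of i] that by simp
  then show ?thesis
    unfolding carry_sequence_def cyc_last cyc_first digit_sum_0 range digit_sum_def[symmetric]
    by metis
qed

lemma carry_sequence_value:
  assumes "r > 0" and "carry_sequence r d c" and "i < 4 * r"
  shows "2 ^ Suc i * c i = (\<Sum>j<Suc i. digit_sum r d j * 2 ^ j) - 1 + c (4 * r - 1)"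
proof (rule carry_partial_sum)
  show "2 * c 0 - c (4 * r - 1) + 1 = digit_sum r d 0"
    and "\<And>i. Suc i < 4 * r \<Longrightarrow> 2 * c (Suc i) - c i = digit_sum r d (Suc i)"
    using assms(2) unfolding carry_sequence_iff[OF \<open>r > 0\<close>] by blast+
qed (fact assms(3))

lemma carry_sequence_last:
  assumes "r > 0" and "carry_sequence r d c"
  shows "(2 ^ (4 * r) - 1) * c (4 * r - 1) = (\<Sum>j<4 * r. digit_sum r d j * 2 ^ j) - 1"
proof -
  have "Suc (4 * r - 1) = 4 * r" using \<open>r > 0\<close> by simp
  then show ?thesis
    using carry_sequence_value[OF assms, of "4 * r - 1"] by (simp add: algebra_simps)
qed

lemma carry_sequence_unique:
  assumes "r > 0" and "carry_sequence r d c" and "carry_sequence r d c'"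
  shows "c = c'"
proof (rule PiE_ext)
  show "c \<in> {..<4 * r} \<rightarrow>\<^sub>E {0, 1, 2}" "c' \<in> {..<4 * r} \<rightarrow>\<^sub>E {0, 1, 2}"
    using assms by (simp_all add: carry_sequence_def)
next
  fix i assume "i \<in> {..<4 * r}"
  \<comment> \<open>Cancelling the modulus shows that the digits alone fix the last carry.\<close>
  have "(2 :: int) ^ (4 * r) - 1 \<noteq> 0"
    using \<open>r > 0\<close> one_less_power[of "2 :: int" "4 * r"] by simp
  then have "c (4 * r - 1) = c' (4 * r - 1)"
    using carry_sequence_last[OF assms(1,2)] carry_sequence_last[OF assms(1,3)]
    by (metis mult_cancel_left)
  then have "2 ^ Suc i * c i = 2 ^ Suc i * c' i"
    using carry_sequence_value[OF assms(1,2)] carry_sequence_value[OF assms(1,3)]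
      \<open>i \<in> {..<4 * r}\<close> by simp
  then show "c i = c' i" by simp
qed

lemma carry_sequence_exists_iff:
  assumes "r > 0" and "\<And>i. i < 4 * r \<Longrightarrow> d i \<in> {0, 1}"
  shows "(\<exists>c. carry_sequence r d c) \<longleftrightarrow>
    [(\<Sum>i<4 * r. digit_sum r d i * 2 ^ i) = 1] (mod (2 ^ (4 * r) - 1))"
proof
  assume "\<exists>c. carry_sequence r d c"
  then obtain c where "carry_sequence r d c" ..
  show "[(\<Sum>i<4 * r. digit_sum r d i * 2 ^ i) = 1] (mod (2 ^ (4 * r) - 1))"
    unfolding cong_iff_dvd_diff carry_sequence_last[OF \<open>r > 0\<close> \<open>carry_sequence r d c\<close>, symmetric]
    by (rule dvd_triv_left)
next
  assume S: "[(\<Sum>i<4 * r. digit_sum r d i * 2 ^ i) = 1] (mod (2 ^ (4 * r) - 1))"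
  have "4 * r > 1" using \<open>r > 0\<close> by simp
  obtain c where "\<And>i. i < 4 * r \<Longrightarrow> c i \<in> {0, 1, 2}"
    "2 * c 0 - c (4 * r - 1) + 1 = digit_sum r d 0"
    "\<And>i. Suc i < 4 * r \<Longrightarrow> 2 * c (Suc i) - c i = digit_sum r d (Suc i)"
    using carry_exists[OF \<open>4 * r > 1\<close> digit_sum_range S, OF assms] by blast
  \<comment> \<open>\<open>c\<close> is arbitrary from \<open>4 * r\<close> on; restricting it makes
    it extensional.\<close>
  then have "carry_sequence r d (restrict c {..<4 * r})"
    unfolding carry_sequence_iff[OF \<open>r > 0\<close>] using \<open>r > 0\<close> by auto
  then show "\<exists>c. carry_sequence r d c" by blast
qed

theorem theorem8:
  fixes r n :: nat and a :: int and d :: "nat \<Rightarrow> int"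
  assumes "odd r" and "n = 4 * r"
    and "a \<in> {1..2 ^ n - 2}"
    and "binary_expansion n a d"
  shows "([a * BL r = 1] (mod (2 ^ n - 1)) \<longleftrightarrow> (\<exists>c. carry_sequence r d c))
    \<and> (\<forall>c c'. carry_sequence r d c \<and> carry_sequence r d c' \<longrightarrow> c = c')"
proof -
  have "r > 0" using \<open>odd r\<close> by (rule odd_pos)
  have digits: "\<And>i. i < 4 * r \<Longrightarrow> d i \<in> {0, 1}" and a: "a = (\<Sum>i<4 * r. d i * 2 ^ i)"
    using assms by (auto simp: binary_expansion_def)
  have "(\<exists>c. carry_sequence r d c) \<longleftrightarrow>
      [(\<Sum>i<4 * r. digit_sum r d i * 2 ^ i) = 1] (mod (2 ^ (4 * r) - 1))"
    by (rule carry_sequence_exists_iff) (fact \<open>r > 0\<close>, fact digits)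
  also have "\<dots> \<longleftrightarrow> [a * BL r = 1] (mod (2 ^ n - 1))"
    using digit_sum_cong[OF \<open>r > 0\<close> a] by (simp only: cong_def \<open>n = 4 * r\<close>)
  finally have "[a * BL r = 1] (mod (2 ^ n - 1)) \<longleftrightarrow> (\<exists>c. carry_sequence r d c)" ..
  then show ?thesis
    using carry_sequence_unique[OF \<open>r > 0\<close>] by blast
qed

end
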